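(* Let $\widehat{X}$ be a sandpile graph such that $\mathcal{M}(\widehat{X})$ contains exactly two idempotents, and let $u\in\mathcal{M}(\widehat{X})$. Then there exists $a\in\mathcal{M}(\widehat{X})$ with $a\neq0$ such that $u\oplus a=u$ if and only if $u$ is recurrent.
   Context: A sandpile graph $\widehat{X}$ is a finite weakly connected directed multigraph (loops and multiple edges allowed) with a distinguished vertex, the sink, reachable by a directed path from every vertex; the set of non-sink vertices is nonempty. A configuration assigns a nonnegative integer number of grains to each non-sink vertex; it is stable if every $v$ holds fewer than $\deg^{+}(v)$ (out-degree) grains. Toppling an unstable vertex sends one grain along each of its out-edges (grains at the sink vanish; the sink never topples); every configuration has a unique stabilization. $\mathcal{M}(\widehat X)$ is the set of stable configurations with $a\oplus b$ = stabilization of $a+b$ (commutative monoid, identity the empty configuration $0$). $a$ is accessible from $b$ if $b\oplus x=a$ for some $x\in\mathcal M(\widehat X)$; $a$ is recurrent if accessible from every element of $\mathcal M(\widehat X)$. *)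

theory Defs
  imports "Graph_Theory.Digraph_Component"
begin

(* fin_digraph admits loops and parallel arcs; connected is weak connectivity. *)
locale sandpile_graph = fin_digraph G for G :: "('a, 'b) pre_digraph" and s :: 'a +
  assumes weakly_connected: "connected G"
    and sink_in_verts: "s \<in> verts G"
    and sink_reachable: "\<And>v. v \<in> verts G \<Longrightarrow> v \<rightarrow>\<^sup>*\<^bsub>G\<^esub> s"
    and nonsink_nonempty: "verts G - {s} \<noteq> {}"

(* Configurations are functions on the whole vertex type; they are required to vanish off the
   non-sink vertices so that equality of functions is equality of configurations. *)
definition configs :: "('a, 'b) pre_digraph \<Rightarrow> 'a \<Rightarrow> ('a \<Rightarrow> nat) set" where
  "configs G s = {c. \<forall>v. v \<notin> verts G - {s} \<longrightarrow> c v = 0}"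

definition stable :: "('a, 'b) pre_digraph \<Rightarrow> 'a \<Rightarrow> ('a \<Rightarrow> nat) \<Rightarrow> bool" where
  "stable G s c \<longleftrightarrow> (\<forall>v \<in> verts G - {s}. c v < out_degree G v)"

(* The subtraction is only meaningful when out_degree G v \<le> c v, which topples ensures. A loop
   at v counts towards out_degree G v and also returns one grain to v. *)
definition topple :: "('a, 'b) pre_digraph \<Rightarrow> 'a \<Rightarrow> 'a \<Rightarrow> ('a \<Rightarrow> nat) \<Rightarrow> ('a \<Rightarrow> nat)" where
  "topple G s v c = (\<lambda>w. if w \<in> verts G - {s}
     then (c w - (if w = v then out_degree G v else 0)) + card {e \<in> out_arcs G v. head G e = w}
     else 0)"

definition topples :: "('a, 'b) pre_digraph \<Rightarrow> 'a \<Rightarrow> ('a \<Rightarrow> nat) \<Rightarrow> ('a \<Rightarrow> nat) \<Rightarrow> bool" where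
  "topples G s c d \<longleftrightarrow> (\<exists>v \<in> verts G - {s}. out_degree G v \<le> c v \<and> d = topple G s v c)"

definition stabilization :: "('a, 'b) pre_digraph \<Rightarrow> 'a \<Rightarrow> ('a \<Rightarrow> nat) \<Rightarrow> ('a \<Rightarrow> nat)" where
  "stabilization G s c = (THE d. (topples G s)\<^sup>*\<^sup>* c d \<and> stable G s d)"

definition sandpile_monoid :: "('a, 'b) pre_digraph \<Rightarrow> 'a \<Rightarrow> ('a \<Rightarrow> nat) set" where
  "sandpile_monoid G s = {c \<in> configs G s. stable G s c}"

definition sandpile_add ::
    "('a, 'b) pre_digraph \<Rightarrow> 'a \<Rightarrow> ('a \<Rightarrow> nat) \<Rightarrow> ('a \<Rightarrow> nat) \<Rightarrow> ('a \<Rightarrow> nat)" where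
  "sandpile_add G s a b = stabilization G s (\<lambda>v. a v + b v)"

definition empty_config :: "'a \<Rightarrow> nat" where
  "empty_config = (\<lambda>v. 0)"

definition idempotents :: "('a, 'b) pre_digraph \<Rightarrow> 'a \<Rightarrow> ('a \<Rightarrow> nat) set" where
  "idempotents G s = {a \<in> sandpile_monoid G s. sandpile_add G s a a = a}"

definition accessible_from ::
    "('a, 'b) pre_digraph \<Rightarrow> 'a \<Rightarrow> ('a \<Rightarrow> nat) \<Rightarrow> ('a \<Rightarrow> nat) \<Rightarrow> bool" where
  "accessible_from G s a b \<longleftrightarrow> (\<exists>x \<in> sandpile_monoid G s. sandpile_add G s b x = a)"

definition recurrent :: "('a, 'b) pre_digraph \<Rightarrow> 'a \<Rightarrow> ('a \<Rightarrow> nat) \<Rightarrow> bool" where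
  "recurrent G s a \<longleftrightarrow> (\<forall>b \<in> sandpile_monoid G s. accessible_from G s a b)"

end

theory Submission
  imports Defs "HOL-Library.Confluence"
begin

text \<open>
  Stabilization is a homomorphism from configurations to the monoid, so every stable configuration
  has an idempotent multiple; a multiple of the maximal stable configuration gives a recurrent
  idempotent \<open>e\<close>, and \<open>e\<close> is not \<open>0\<close> because otherwise the monoid would be a group and \<open>0\<close> its only
  idempotent. Hence the idempotents are \<open>0\<close> and \<open>e\<close>, and \<open>u\<close> is recurrent iff \<open>u \<oplus> e = u\<close>.

  The remaining point is that if \<open>u \<oplus> a = u\<close> with \<open>a \<noteq> 0\<close>, then the idempotent multiple of \<open>a\<close> is not
  \<open>0\<close>. Since \<open>a v\<close> is smaller than the out-degree of \<open>v\<close>, every \<open>v\<close> in the support of \<open>a\<close> must receive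
  a grain while \<open>u + a\<close> stabilizes to \<open>u\<close>, so it is a proper descendant of a vertex of the support.
  By finiteness, some \<open>v\<close> in the support lies on a cycle avoiding the sink, and a cycle that
  holds a grain never becomes empty.
\<close>

context sandpile_graph
begin

abbreviation nonsink :: "'a set" where
  "nonsink \<equiv> verts G - {s}"

abbreviation stab :: "('a \<Rightarrow> nat) \<Rightarrow> ('a \<Rightarrow> nat)" where
  "stab \<equiv> stabilization G s"

abbreviation arc_count :: "'a \<Rightarrow> 'a \<Rightarrow> nat" where
  "arc_count v w \<equiv> card {e \<in> out_arcs G v. head G e = w}"

text \<open>The arc relation of the graph with the sink deleted. Loops are kept, so
  \<open>(v, v) \<in> nonsink_arcs\<^sup>+\<close> holds exactly when \<open>v\<close> lies on a
  closed walk of positive length avoiding the sink.\<close>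

definition nonsink_arcs :: "('a \<times> 'a) set" where
  "nonsink_arcs = {(v, w). v \<in> nonsink \<and> w \<in> nonsink \<and> arc_count v w > 0}"

subsection \<open>Stabilization\<close>

text \<open>Weighting each grain by \<open>W\<close> makes toppling terminate: the grains leaving
  \<open>v\<close> have total weight \<open>out_degree G v * W v\<close>, and those arriving at the
  heads weigh strictly less.\<close>

lemma ex_superharmonic_weight:
  "\<exists>W :: 'a \<Rightarrow> nat. W s = 0 \<and>
     (\<forall>v\<in>nonsink. (\<Sum>e\<in>out_arcs G v. W (head G e)) < out_degree G v * W v)"
proof -
  \<comment> \<open>Directed distance to the sink; a path exists by \<open>sink_reachable\<close>,
    so the minimum is attained.\<close>
  define d where "d v = (LEAST n. (v, s) \<in> arcs_ends G ^^ n)" for v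
  define N where "N = Max (d ` verts G)"
  define K where "K = Suc (card (arcs G))"
  \<comment> \<open>With \<open>K\<close> larger than every out-degree, the gain from the one head nearer to the sink
    outweighs the crude bound \<open>K ^ N\<close> on the weights of all other heads.\<close>
  define W where "W v = K ^ N - K ^ (N - d v)" for v
  have K: "K \<ge> 1" by (simp add: K_def)
  have dN: "d v \<le> N" if "v \<in> verts G" for v
    using that by (simp add: N_def)
  have d0: "d s = 0" by (simp add: d_def)
  have dmem: "(v, s) \<in> arcs_ends G ^^ d v" if "v \<in> verts G" for v
  proof -
    have "(v, s) \<in> (arcs_ends G)\<^sup>*"
      using sink_reachable[OF that] by (rule reachable_rtranclI)
    then show ?thesis
      unfolding d_def rtrancl_power by (metis LeastI)
  qed
  have "(\<Sum>e\<in>out_arcs G v. W (head G e)) < out_degree G v * W v" if v: "v \<in> nonsink" for v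
  proof -
    have "d v \<noteq> 0"
      using dmem[of v] v by (metis DiffE IdD insertI1 relpow.simps(1))
    then obtain n where n: "d v = Suc n" by (cases "d v") auto
    then obtain w where vw: "(v, w) \<in> arcs_ends G" and ws: "(w, s) \<in> arcs_ends G ^^ n"
      using dmem[of v] v by (metis DiffD1 relpow_Suc_E2)
    then have dw: "d w \<le> n" unfolding d_def by (metis Least_le)
    obtain e where e: "e \<in> out_arcs G v" "head G e = w"
      using vw by (auto simp: arcs_ends_def arc_to_ends_def)
    have "out_degree G v \<le> card (arcs G)"
      unfolding out_degree_def by (intro card_mono) auto
    then have deg: "out_degree G v < K" by (simp add: K_def)
    have nN: "Suc n \<le> N" using dN[of v] v n by simp
    have fin: "finite (out_arcs G v)" by (rule finite_out_arcs)
    have "(\<Sum>e\<in>out_arcs G v. W (head G e)) = W w + (\<Sum>e\<in>out_arcs G v - {e}. W (head G e))"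
      using sum.remove[OF fin e(1), of "\<lambda>e. W (head G e)"] e(2) by simp
    also have "\<dots> \<le> W w + (\<Sum>e\<in>out_arcs G v - {e}. K ^ N)"
      by (intro add_left_mono sum_mono) (simp add: W_def)
    also have "\<dots> = W w + (out_degree G v - 1) * K ^ N"
      using e fin by (simp add: out_degree_def)
    finally have 1: "(\<Sum>e\<in>out_arcs G v. W (head G e)) \<le> W w + (out_degree G v - 1) * K ^ N" .
    have pos: "out_degree G v > 0"
      using e fin by (auto simp: out_degree_def card_gt_0_iff)
    have pow: "K ^ (N - n) \<le> K ^ (N - d w)" "K ^ (N - d w) \<le> K ^ N"
      using K dw by (auto intro!: power_increasing)
    have "K ^ (N - n) = K * K ^ (N - Suc n)"
      using nN by (metis Suc_diff_le diff_Suc_Suc power_Suc)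
    moreover have "out_degree G v * K ^ (N - Suc n) < K * K ^ (N - Suc n)"
      using deg K by simp
    ultimately have 2: "out_degree G v * K ^ (N - Suc n) < K ^ (N - d w)"
      using pow by linarith
    have "W w + (out_degree G v - 1) * K ^ N + K ^ (N - d w) = out_degree G v * K ^ N"
      using pow pos by (cases "out_degree G v") (auto simp: W_def)
    with 1 2 have "(\<Sum>e\<in>out_arcs G v. W (head G e))
        < out_degree G v * K ^ N - out_degree G v * K ^ (N - Suc n)"
      by linarith
    then show ?thesis by (simp add: W_def n diff_mult_distrib2)
  qed
  then show ?thesis
    by (intro exI[of _ W]) (simp add: W_def d0)
qed

lemma topple_config: "topple G s v c \<in> configs G s"
  by (simp add: topple_def configs_def)

lemma topples_rtranclp_config:
  "(topples G s)\<^sup>*\<^sup>* c d \<Longrightarrow> c \<in> configs G s \<Longrightarrow> d \<in> configs G s"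
  by (induction rule: rtranclp_induct) (auto simp: topples_def topple_config)

lemma ex_topples_decreasing:
  obtains \<Phi> :: "('a \<Rightarrow> nat) \<Rightarrow> nat" where "\<And>c d. topples G s c d \<Longrightarrow> \<Phi> d < \<Phi> c"
proof -
  obtain W where W0: "W s = 0"
    and W: "\<And>v. v \<in> nonsink \<Longrightarrow> (\<Sum>e\<in>out_arcs G v. W (head G e)) < out_degree G v * W v"
    using ex_superharmonic_weight by auto
  define \<Phi> where "\<Phi> c = (\<Sum>w\<in>nonsink. c w * W w)" for c :: "'a \<Rightarrow> nat"
  have "\<Phi> d < \<Phi> c" if top: "topples G s c d" for c d
  proof -
    obtain v where v: "v \<in> nonsink" "out_degree G v \<le> c v" "d = topple G s v c"
      using top unfolding topples_def by blast
    let ?r = "\<lambda>w. if w = v then out_degree G v else 0"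
    \<comment> \<open>The lost weight is added on the left, so that no truncated subtraction
      occurs.\<close>
    have "\<Phi> d + out_degree G v * W v = \<Phi> d + (\<Sum>w\<in>nonsink. ?r w * W w)"
      using v(1) by (simp add: if_distrib[of "\<lambda>x. x * _"] sum.delta' sum.delta cong: if_cong)
    also have "\<dots> = (\<Sum>w\<in>nonsink. c w * W w + arc_count v w * W w)"
      unfolding \<Phi>_def sum.distrib[symmetric]
    proof (rule sum.cong)
      fix w assume "w \<in> nonsink"
      then have "d w + ?r w = c w + arc_count v w"
        using v by (auto simp: topple_def)
      then show "d w * W w + ?r w * W w = c w * W w + arc_count v w * W w"
        by (metis add_mult_distrib)
    qed simp
    \<comment> \<open>Since \<open>W s = 0\<close>, the sink can be included, and the sum over
      vertices then regroups the out-arcs of \<open>v\<close> by their heads.\<close>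
    also have "\<dots> = \<Phi> c + (\<Sum>w\<in>verts G. arc_count v w * W w)"
      by (simp add: \<Phi>_def sum.distrib sum.remove[OF _ sink_in_verts] W0)
    also have "(\<Sum>w\<in>verts G. arc_count v w * W w)
        = (\<Sum>w\<in>verts G. \<Sum>e\<in>{e \<in> out_arcs G v. head G e = w}. W (head G e))"
      by (intro sum.cong) auto
    also have "\<dots> = (\<Sum>e\<in>out_arcs G v. W (head G e))"
      by (intro sum.group) auto
    finally show ?thesis using W[OF v(1)] by linarith
  qed
  then show ?thesis using that by blast
qed

lemma stable_iff_no_topples: "stable G s c \<longleftrightarrow> (\<forall>d. \<not> topples G s c d)"
  unfolding stable_def topples_def by (metis linorder_not_le)

lemma ex_stable: "\<exists>d. (topples G s)\<^sup>*\<^sup>* c d \<and> stable G s d"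
proof -
  obtain \<Phi> :: "('a \<Rightarrow> nat) \<Rightarrow> nat" where \<Phi>: "\<And>c d. topples G s c d \<Longrightarrow> \<Phi> d < \<Phi> c"
    using ex_topples_decreasing by blast
  show ?thesis
  proof (induction c rule: measure_induct_rule[of \<Phi>])
    case (less c)
    then show ?case
      using \<Phi> by (metis converse_rtranclp_into_rtranclp rtranclp.rtrancl_refl stable_iff_no_topples)
  qed
qed

text \<open>Topplings at distinct vertices commute, and topplings at the same vertex coincide, so
  one step on each side closes every fork.\<close>

lemma confluent_topples: "confluentp (topples G s)"
proof (rule strong_confluentp_imp_confluentp, rule strong_confluentpI)
  fix c d d'
  assume "topples G s c d" "topples G s c d'"
  then obtain v w where v: "v \<in> nonsink" "out_degree G v \<le> c v" "d = topple G s v c"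
    and w: "w \<in> nonsink" "out_degree G w \<le> c w" "d' = topple G s w c"
    unfolding topples_def by blast
  show "\<exists>e. (topples G s)\<^sup>*\<^sup>* d e \<and> (topples G s)\<^sup>=\<^sup>= d' e"
  proof (cases "v = w")
    case True
    then show ?thesis using v w by auto
  next
    case False
    \<comment> \<open>A toppling elsewhere never lowers a pile, so each move stays legal after the
      other.\<close>
    then have "out_degree G w \<le> d w" "out_degree G v \<le> d' v"
      using v w by (auto simp: topple_def)
    moreover have "topple G s w d = topple G s v d'"
      using False v w by (auto simp: topple_def fun_eq_iff)
    ultimately have "topples G s d (topple G s w d)" "topples G s d' (topple G s w d)"
      using v(1) w(1) unfolding topples_def by metis+
    then show ?thesis by auto
  qed
qed

lemma stabilization_eqI:
  assumes "(topples G s)\<^sup>*\<^sup>* c d" "stable G s d"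
  shows "stab c = d"
  unfolding stabilization_def
proof (rule the_equality)
  show "(topples G s)\<^sup>*\<^sup>* c d \<and> stable G s d" using assms by simp
next
  fix d' assume d': "(topples G s)\<^sup>*\<^sup>* c d' \<and> stable G s d'"
  then obtain e where "(topples G s)\<^sup>*\<^sup>* d e" "(topples G s)\<^sup>*\<^sup>* d' e"
    using confluentpD[OF confluent_topples] assms by blast
  \<comment> \<open>Stable configurations are irreducible, so both reductions to \<open>e\<close>
    are trivial.\<close>
  then show "d' = d"
    using d' assms(2) by (metis converse_rtranclpE stable_iff_no_topples)
qed

lemma topples_stabilization: "(topples G s)\<^sup>*\<^sup>* c (stab c)"
  using ex_stable stabilization_eqI by metis

lemma stable_stabilization: "stable G s (stab c)"
  using ex_stable stabilization_eqI by metis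

lemma stabilization_stable: "stable G s c \<Longrightarrow> stab c = c"
  by (simp add: stabilization_eqI)

lemma stabilization_in_monoid: "c \<in> configs G s \<Longrightarrow> stab c \<in> sandpile_monoid G s"
  using stable_stabilization topples_stabilization topples_rtranclp_config
  by (auto simp: sandpile_monoid_def)

lemma stabilization_topples: "(topples G s)\<^sup>*\<^sup>* c d \<Longrightarrow> stab c = stab d"
  by (meson rtranclp_trans stabilization_eqI stable_stabilization topples_stabilization)

section \<open>Compatibility of stabilization with addition, and the monoid laws\<close>

lemma topples_add:
  assumes "topples G s c d" "b \<in> configs G s"
  shows "topples G s (\<lambda>v. c v + b v) (\<lambda>v. d v + b v)"
proof -
  obtain v where v: "v \<in> nonsink" "out_degree G v \<le> c v" "d = topple G s v c"
    using assms(1) unfolding topples_def by blast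
  \<comment> \<open>Here \<open>b\<close> must vanish off the non-sink vertices, because
    \<open>topple\<close> resets all other values to 0.\<close>
  then have "(\<lambda>w. d w + b w) = topple G s v (\<lambda>w. c w + b w)"
    using assms(2) by (auto simp: topple_def configs_def fun_eq_iff)
  moreover have "out_degree G v \<le> c v + b v" using v(2) by simp
  ultimately show ?thesis using v(1) unfolding topples_def by blast
qed

lemma topples_rtranclp_add:
  assumes "(topples G s)\<^sup>*\<^sup>* c d" "b \<in> configs G s"
  shows "(topples G s)\<^sup>*\<^sup>* (\<lambda>v. c v + b v) (\<lambda>v. d v + b v)"
  using assms(1)
proof (induction rule: rtranclp_induct)
  case (step d d')
  then show ?case using topples_add[OF step(2) assms(2)] by (metis rtranclp.rtrancl_into_rtrancl)
qed simp

text \<open>Stabilizing one summand first only performs some legal topplings of the sum early, which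
  does not affect the outcome. Associativity rests on this.\<close>

lemma stabilization_add_left:
  "b \<in> configs G s \<Longrightarrow> stab (\<lambda>v. stab a v + b v) = stab (\<lambda>v. a v + b v)"
  by (rule stabilization_topples[symmetric])
     (rule topples_rtranclp_add[OF topples_stabilization])

lemma configs_add:
  "a \<in> configs G s \<Longrightarrow> b \<in> configs G s \<Longrightarrow> (\<lambda>v. a v + b v) \<in> configs G s"
  by (simp add: configs_def)

lemma configs_mult: "a \<in> configs G s \<Longrightarrow> (\<lambda>v. n * a v) \<in> configs G s"
  by (simp add: configs_def)

lemma stabilization_add_right:
  "a \<in> configs G s \<Longrightarrow> stab (\<lambda>v. a v + stab b v) = stab (\<lambda>v. a v + b v)"
  using stabilization_add_left[of a b] by (simp add: add.commute)

lemma monoid_config: "a \<in> sandpile_monoid G s \<Longrightarrow> a \<in> configs G s"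
  by (simp add: sandpile_monoid_def)

lemma stabilization_monoid: "a \<in> sandpile_monoid G s \<Longrightarrow> stab a = a"
  by (simp add: sandpile_monoid_def stabilization_stable)

lemma sandpile_add_stabilization:
  assumes "a \<in> configs G s" "b \<in> configs G s"
  shows "sandpile_add G s (stab a) (stab b) = stab (\<lambda>v. a v + b v)"
  using assms monoid_config[OF stabilization_in_monoid]
  by (simp add: sandpile_add_def stabilization_add_left stabilization_add_right)

lemma sandpile_add_commute: "sandpile_add G s a b = sandpile_add G s b a"
  by (simp add: sandpile_add_def add.commute)

lemma sandpile_add_closed:
  "a \<in> sandpile_monoid G s \<Longrightarrow> b \<in> sandpile_monoid G s \<Longrightarrow> sandpile_add G s a b \<in> sandpile_monoid G s"
  by (simp add: sandpile_add_def stabilization_in_monoid monoid_config configs_add)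

lemma sandpile_add_assoc:
  assumes "a \<in> sandpile_monoid G s" "b \<in> sandpile_monoid G s" "c \<in> sandpile_monoid G s"
  shows "sandpile_add G s (sandpile_add G s a b) c = sandpile_add G s a (sandpile_add G s b c)"
  using assms monoid_config
  by (simp add: sandpile_add_def stabilization_add_left stabilization_add_right add.assoc)

subsection \<open>Idempotents\<close>

text \<open>With out-degree 0 the strict weight inequality would have right-hand side 0. Positivity
  makes the empty configuration stable.\<close>

lemma out_degree_pos:
  assumes "v \<in> nonsink"
  shows "out_degree G v > 0"
  using ex_superharmonic_weight assms by (metis gr0I mult_0 not_less_zero)

lemma finite_sandpile_monoid: "finite (sandpile_monoid G s)"
proof (rule finite_subset)
  let ?B = "{c. \<forall>v. (v \<in> nonsink \<longrightarrow> c v \<in> {..card (arcs G)}) \<and> (v \<notin> nonsink \<longrightarrow> c v = 0)}"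
  have "out_degree G v \<le> card (arcs G)" for v
    unfolding out_degree_def by (intro card_mono) auto
  then show "sandpile_monoid G s \<subseteq> ?B"
    unfolding sandpile_monoid_def configs_def stable_def
    by (auto intro: order.trans[OF less_imp_le])
  show "finite ?B"
    by (rule finite_set_of_finite_funs) auto
qed

lemma empty_in_monoid: "empty_config \<in> sandpile_monoid G s"
  using out_degree_pos
  by (simp add: sandpile_monoid_def configs_def stable_def empty_config_def)

lemma sandpile_add_empty: "a \<in> sandpile_monoid G s \<Longrightarrow> sandpile_add G s a empty_config = a"
  by (simp add: sandpile_add_def empty_config_def stabilization_monoid)

text \<open>By finiteness the sequence of stabilized multiples is eventually periodic; a positive
  multiple of the period beyond the preperiod gives an idempotent.\<close>

lemma ex_idempotent_multiple:
  assumes a: "a \<in> configs G s"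
  obtains n where "n > 0" "stab (\<lambda>v. n * a v) \<in> idempotents G s"
proof -
  define m where "m n = stab (\<lambda>v. n * a v)" for n :: nat
  have m_mem: "m n \<in> sandpile_monoid G s" for n
    unfolding m_def by (intro stabilization_in_monoid configs_mult a)
  have m_add: "sandpile_add G s (m i) (m j) = m (i + j)" for i j
    unfolding m_def using a
    by (simp add: sandpile_add_stabilization configs_mult add_mult_distrib)
  have "\<not> inj m"
    using finite_subset[OF _ finite_sandpile_monoid, of "range m"] m_mem
    by (meson finite_imageD image_subsetI infinite_UNIV_nat)
  then obtain i j where ij: "i < j" "m i = m j"
    unfolding inj_on_def by (metis nat_neq_iff)
  define p where "p = j - i"
  have period: "m (k + p) = m k" if "i \<le> k" for k
  proof -
    have "m (k + p) = sandpile_add G s (m j) (m (k - i))"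
      using that ij(1) by (simp add: m_add p_def add.commute)
    also have "\<dots> = m k" using that by (simp add: ij(2)[symmetric] m_add)
    finally show ?thesis .
  qed
  have periods: "m (k + l * p) = m k" if "i \<le> k" for k l
  proof (induction l)
    case (Suc l)
    then show ?case using period[of "k + l * p"] that by (simp add: ac_simps)
  qed simp
  \<comment> \<open>The factor \<open>Suc i\<close> ensures both \<open>i \<le> n\<close> and, even
    for \<open>i = 0\<close>, \<open>n > 0\<close>.\<close>
  define n where "n = Suc i * p"
  have p: "p > 0" using ij by (simp add: p_def)
  then have "i \<le> n" by (cases p) (auto simp: n_def)
  then have "m (n + n) = m n" using periods[of n "Suc i"] by (simp add: n_def)
  then have "m n \<in> idempotents G s"
    by (simp add: idempotents_def m_mem m_add)
  then show ?thesis using that[of n] p by (simp add: m_def n_def)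
qed

lemma ex_recurrent_idempotent:
  obtains e where "e \<in> idempotents G s" "recurrent G s e"
proof -
  \<comment> \<open>The maximal stable configuration: every stable \<open>b\<close> lies pointwise
    below it.\<close>
  define c where "c v = (if v \<in> nonsink then out_degree G v - 1 else 0)" for v
  have c: "c \<in> configs G s" by (simp add: c_def configs_def)
  obtain n where n: "n > 0" "stab (\<lambda>v. n * c v) \<in> idempotents G s"
    using ex_idempotent_multiple[OF c] .
  have "accessible_from G s (stab (\<lambda>v. n * c v)) b" if b: "b \<in> sandpile_monoid G s" for b
  proof -
    \<comment> \<open>The grains missing from \<open>b\<close>. They may form an unstable
      configuration, so \<open>stab r\<close> serves as the witness.\<close>
    define r where "r v = n * c v - b v" for v
    have r: "r \<in> configs G s" using c by (simp add: configs_def r_def)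
    have "b v \<le> c v" for v
      using b by (cases "v \<in> nonsink")
        (auto simp: sandpile_monoid_def configs_def stable_def c_def dest!: bspec[of _ _ v])
    moreover have "c v \<le> n * c v" for v using n(1) by simp
    ultimately have "b v \<le> n * c v" for v by (meson order.trans)
    then have "(\<lambda>v. n * c v) = (\<lambda>v. b v + r v)"
      by (simp add: r_def fun_eq_iff)
    then have "stab (\<lambda>v. n * c v) = sandpile_add G s b (stab r)"
      using b by (simp add: sandpile_add_def stabilization_add_right monoid_config)
    then show ?thesis
      using stabilization_in_monoid[OF r] by (auto simp: accessible_from_def)
  qed
  then show ?thesis using that n by (simp add: recurrent_def)
qed

lemma idempotents_eq:
  assumes card2: "card (idempotents G s) = 2"
    and e: "e \<in> idempotents G s" "recurrent G s e"
  shows "e \<noteq> empty_config" "idempotents G s = {empty_config, e}"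
proof -
  have empty: "empty_config \<in> idempotents G s"
    by (simp add: idempotents_def empty_in_monoid sandpile_add_empty)
  show ne: "e \<noteq> empty_config"
  proof
    assume "e = empty_config"
    have "b = empty_config" if b: "b \<in> idempotents G s" for b
    proof -
      have bm: "b \<in> sandpile_monoid G s" "sandpile_add G s b b = b"
        using b by (auto simp: idempotents_def)
      obtain x where x: "x \<in> sandpile_monoid G s" "sandpile_add G s b x = empty_config"
        using e(2) bm \<open>e = empty_config\<close> by (auto simp: recurrent_def accessible_from_def)
      \<comment> \<open>Adding the inverse \<open>x\<close> to \<open>b \<oplus> b = b\<close>
        cancels one copy of \<open>b\<close> and leaves \<open>b = 0\<close>.\<close>
      show ?thesis
        using sandpile_add_assoc[OF bm(1) bm(1) x(1)] bm x by (simp add: sandpile_add_empty)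
    qed
    then have "idempotents G s \<subseteq> {empty_config}" by blast
    then have "card (idempotents G s) \<le> card {empty_config :: 'a \<Rightarrow> nat}"
      by (intro card_mono) simp_all
    then show False using card2 by simp
  qed
  show "idempotents G s = {empty_config, e}"
  proof (rule card_subset_eq[symmetric])
    show "finite (idempotents G s)" using card2 by (intro card_ge_0_finite) simp
    show "{empty_config, e} \<subseteq> idempotents G s" using empty e(1) by simp
    show "card {empty_config, e} = card (idempotents G s)" using ne card2 by simp
  qed
qed

text \<open>Adding a further \<open>u\<close> to a way of reaching \<open>e\<close> gives a way of
  reaching \<open>e \<oplus> u\<close>.\<close>

lemma recurrent_add:
  assumes "recurrent G s e" "e \<in> sandpile_monoid G s" "u \<in> sandpile_monoid G s"
  shows "recurrent G s (sandpile_add G s e u)"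
  unfolding recurrent_def
proof
  fix b assume b: "b \<in> sandpile_monoid G s"
  then obtain x where "x \<in> sandpile_monoid G s" "sandpile_add G s b x = e"
    using assms(1) by (auto simp: recurrent_def accessible_from_def)
  then show "accessible_from G s (sandpile_add G s e u) b"
    using assms b sandpile_add_assoc sandpile_add_closed
    by (auto simp: accessible_from_def intro!: bexI[of _ "sandpile_add G s x u"])
qed

subsection \<open>Cycles avoiding the sink\<close>

text \<open>\<open>P\<close> consists of the proper descendants of the support of \<open>a\<close>.
  Off \<open>P\<close> and the support, piles keep their stable value from \<open>u\<close> and
  cannot topple; hence no vertex off \<open>P\<close> receives a grain, and its pile changes only by
  whole out-degrees. The number \<open>x\<close> counts the topplings at \<open>v\<close>.\<close>

lemma topples_grain_balance:
  assumes u: "stable G s u" "u \<in> configs G s" and a: "a \<in> configs G s"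
    and "(topples G s)\<^sup>*\<^sup>* (\<lambda>v. u v + a v) d"
  defines "P \<equiv> nonsink_arcs\<^sup>+ `` {v. a v > 0}"
  shows "(\<forall>v. v \<notin> P \<longrightarrow> a v = 0 \<longrightarrow> d v = u v) \<and>
         (\<forall>v. v \<notin> P \<longrightarrow> (\<exists>x. d v + out_degree G v * x = u v + a v))"
  using assms(4)
proof (induction rule: rtranclp_induct)
  case base
  show ?case by (auto intro: exI[of _ 0])
next
  case (step d d')
  then obtain z where z: "z \<in> nonsink" "out_degree G z \<le> d z" "d' = topple G s z d"
    unfolding topples_def by blast
  have "d z \<noteq> u z"
    using z(1,2) u(1) unfolding stable_def by (metis linorder_not_le)
  then have zR: "z \<in> P \<or> a z > 0"
    using step.IH by auto
  have no_arc: "arc_count z v = 0" if "v \<notin> P" "v \<in> nonsink" for v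
  proof (rule ccontr)
    assume "arc_count z v \<noteq> 0"
    then have "(z, v) \<in> nonsink_arcs" using z(1) that(2) unfolding nonsink_arcs_def by blast
    then have "v \<in> P" using zR unfolding P_def by (auto intro: trancl_into_trancl)
    with that show False by simp
  qed
  have out: "d' v = u v" if "v \<notin> nonsink" for v
    using that z(3) u(2) by (auto simp: topple_def configs_def)
  have eq: "d' v + (if v = z then out_degree G v else 0) = d v" if "v \<notin> P" "v \<in> nonsink" for v
    using no_arc[OF that] that z by (auto simp: topple_def)
  show ?case
  proof (intro conjI allI impI)
    fix v assume v: "v \<notin> P" "a v = 0"
    then have "v \<noteq> z" using zR by auto
    then show "d' v = u v"
      using out eq[of v] v step.IH by (cases "v \<in> nonsink") auto
  next
    fix v assume v: "v \<notin> P"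
    show "\<exists>x. d' v + out_degree G v * x = u v + a v"
    proof (cases "v \<in> nonsink")
      case True
      obtain x where "d v + out_degree G v * x = u v + a v" using step.IH v by blast
      then show ?thesis using eq[OF v True]
        by (intro exI[of _ "x + (if v = z then 1 else 0)"]) (auto simp: algebra_simps split: if_splits)
    next
      case False
      then show ?thesis using out[OF False] a by (intro exI[of _ 0]) (simp add: configs_def)
    qed
  qed
qed

lemma ex_cycle_if_stabilizer:
  assumes u: "u \<in> sandpile_monoid G s" and a: "a \<in> sandpile_monoid G s"
    and ne: "a \<noteq> empty_config" and eq: "sandpile_add G s u a = u"
  obtains v where "a v > 0" "(v, v) \<in> nonsink_arcs\<^sup>+"
proof -
  let ?S = "{v. a v > 0}"
  have top: "(topples G s)\<^sup>*\<^sup>* (\<lambda>v. u v + a v) u"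
    using topples_stabilization[of "\<lambda>v. u v + a v"] eq by (simp add: sandpile_add_def)
  have "\<exists>z\<in>?S. (z, v) \<in> nonsink_arcs\<^sup>+" if v: "v \<in> ?S" for v
  proof (rule ccontr)
    assume "\<not> ?thesis"
    then have "v \<notin> nonsink_arcs\<^sup>+ `` ?S" by blast
    then obtain x where "u v + out_degree G v * x = u v + a v"
      using topples_grain_balance[OF _ _ _ top] u a unfolding sandpile_monoid_def by blast
    \<comment> \<open>The balance says that \<open>a v\<close> is a multiple of the out-degree,
      impossible for \<open>0 < a v < out_degree G v\<close>.\<close>
    moreover have "a v < out_degree G v"
      using v a by (cases "v \<in> nonsink") (auto simp: sandpile_monoid_def configs_def stable_def)
    ultimately show False using v by (cases x) auto
  qed
  then have pred: "\<exists>z\<in>?S. (z, v) \<in> nonsink_arcs\<^sup>+ \<inter> ?S \<times> ?S" if "v \<in> ?S" for v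
    using that by blast
  have "?S \<subseteq> nonsink"
    using a by (force simp: sandpile_monoid_def configs_def)
  then have "finite ?S" by (rule finite_subset) simp
  \<comment> \<open>Restricting to the support makes the relation finite; as every element has a
    predecessor, it is not well-founded and must contain a cycle.\<close>
  then have fin: "finite (nonsink_arcs\<^sup>+ \<inter> ?S \<times> ?S)" by blast
  have "?S \<noteq> {}" using ne by (auto simp: empty_config_def fun_eq_iff)
  then have "\<not> wf (nonsink_arcs\<^sup>+ \<inter> ?S \<times> ?S)"
    using pred by (metis (no_types, lifting) ex_in_conv wfE_min)
  then obtain v where v: "(v, v) \<in> (nonsink_arcs\<^sup>+ \<inter> ?S \<times> ?S)\<^sup>+"
    using finite_acyclic_wf[OF fin] by (auto simp: acyclic_def)
  have "trans (nonsink_arcs\<^sup>+ \<inter> ?S \<times> ?S)"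
    by (intro transI) (auto intro: trancl_trans)
  then have "(v, v) \<in> nonsink_arcs\<^sup>+ \<inter> ?S \<times> ?S" using v by simp
  then show ?thesis using that by auto
qed

text \<open>The invariant asks only for a grain at some ancestor of \<open>v\<close>, not on a fixed
  cycle. When that vertex topples, a grain moves one arc closer to \<open>v\<close>.\<close>

lemma topples_cycle_nonempty:
  assumes v: "(v, v) \<in> nonsink_arcs\<^sup>+" and c: "c v > 0" and "(topples G s)\<^sup>*\<^sup>* c d"
  shows "\<exists>w. (w, v) \<in> nonsink_arcs\<^sup>+ \<and> d w > 0"
  using assms(3)
proof (induction rule: rtranclp_induct)
  case base
  then show ?case using v c by blast
next
  case (step d d')
  obtain w where w: "(w, v) \<in> nonsink_arcs\<^sup>+" "d w > 0" using step.IH by blast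
  obtain z where z: "z \<in> nonsink" "d' = topple G s z d"
    using step.hyps(2) unfolding topples_def by blast
  obtain w' where w': "(w, w') \<in> nonsink_arcs" "(w', v) \<in> nonsink_arcs\<^sup>*"
    using tranclD[OF w(1)] by blast
  show ?case
  proof (cases "w = z")
    case True
    \<comment> \<open>If the grain has arrived at \<open>v\<close> itself, the cycle through
      \<open>v\<close> supplies the walk of positive length.\<close>
    have "(w', v) \<in> nonsink_arcs\<^sup>+" using w'(2) v by (metis rtranclD)
    moreover have "d' w' > 0" using w'(1) True z by (auto simp: nonsink_arcs_def topple_def)
    ultimately show ?thesis by blast
  next
    case False
    moreover have "w \<in> nonsink" using w'(1) by (auto simp: nonsink_arcs_def)
    ultimately have "d' w > 0" using w(2) z by (simp add: topple_def)
    then show ?thesis using w(1) by blast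
  qed
qed

section \<open>Nonzero idempotents fixing a configuration\<close>

lemma sandpile_add_multiple:
  assumes u: "u \<in> sandpile_monoid G s" and a: "a \<in> sandpile_monoid G s"
    and eq: "sandpile_add G s u a = u"
  shows "sandpile_add G s u (stab (\<lambda>v. n * a v)) = u"
proof -
  have u': "u \<in> configs G s" and a': "a \<in> configs G s" using u a by (auto intro: monoid_config)
  have "stab (\<lambda>v. u v + n * a v) = u"
  proof (induction n)
    case 0
    then show ?case using u by (simp add: stabilization_monoid)
  next
    case (Suc n)
    have "stab (\<lambda>v. u v + Suc n * a v) = stab (\<lambda>v. (u v + n * a v) + a v)"
      by (simp add: ac_simps)
    also have "\<dots> = stab (\<lambda>v. stab (\<lambda>v. u v + n * a v) v + a v)"
      using stabilization_add_left[OF a', of "\<lambda>v. u v + n * a v"] by simp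
    also have "\<dots> = u" using Suc eq by (simp add: sandpile_add_def)
    finally show ?case .
  qed
  then show ?thesis using u' by (simp add: sandpile_add_def stabilization_add_right)
qed

lemma ex_idempotent_stabilizer:
  assumes u: "u \<in> sandpile_monoid G s" and a: "a \<in> sandpile_monoid G s"
    and ne: "a \<noteq> empty_config" and eq: "sandpile_add G s u a = u"
  obtains f where "f \<in> idempotents G s" "f \<noteq> empty_config" "sandpile_add G s u f = u"
proof -
  obtain v where v: "a v > 0" "(v, v) \<in> nonsink_arcs\<^sup>+"
    using ex_cycle_if_stabilizer[OF assms] .
  obtain n where n: "n > 0" "stab (\<lambda>v. n * a v) \<in> idempotents G s"
    using ex_idempotent_multiple[OF monoid_config[OF a]] .
  have "\<exists>w. stab (\<lambda>v. n * a v) w > 0"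
    using topples_cycle_nonempty[OF v(2) _ topples_stabilization, of "\<lambda>v. n * a v"] v n by auto
  then have "stab (\<lambda>v. n * a v) \<noteq> empty_config" by (auto simp: empty_config_def)
  then show ?thesis using that n sandpile_add_multiple[OF u a eq] by blast
qed

end

theorem theorem4p2:
  fixes G :: "('a, 'b) pre_digraph" and s :: 'a and u :: "'a \<Rightarrow> nat"
  assumes "sandpile_graph G s"
    and "card (idempotents G s) = 2"
    and "u \<in> sandpile_monoid G s"
  shows "(\<exists>a \<in> sandpile_monoid G s. a \<noteq> empty_config \<and> sandpile_add G s u a = u)
           \<longleftrightarrow> recurrent G s u"
proof -
  interpret sandpile_graph G s by fact
  obtain e where e: "e \<in> idempotents G s" "recurrent G s e"
    using ex_recurrent_idempotent .
  note idem = idempotents_eq[OF assms(2) e]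
  have em: "e \<in> sandpile_monoid G s" "sandpile_add G s e e = e"
    using e(1) by (auto simp: idempotents_def)
  show ?thesis
  proof
    assume "\<exists>a \<in> sandpile_monoid G s. a \<noteq> empty_config \<and> sandpile_add G s u a = u"
    \<comment> \<open>The nonzero idempotent fixing \<open>u\<close> can only be
      \<open>e\<close>.\<close>
    then have "sandpile_add G s u e = u"
      using ex_idempotent_stabilizer[OF assms(3)] idem by (metis insertE singletonD)
    then show "recurrent G s u"
      using recurrent_add[OF e(2) em(1) assms(3)] by (simp add: sandpile_add_commute)
  next
    assume "recurrent G s u"
    then obtain x where x: "x \<in> sandpile_monoid G s" "sandpile_add G s e x = u"
      using em(1) by (auto simp: recurrent_def accessible_from_def)
    \<comment> \<open>As \<open>u = e \<oplus> x\<close>, a further \<open>e\<close> is absorbed by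
      idempotence.\<close>
    then have "sandpile_add G s u e = u"
      using sandpile_add_assoc[OF em(1) em(1) x(1)] em(2) by (simp add: sandpile_add_commute)
    then show "\<exists>a \<in> sandpile_monoid G s. a \<noteq> empty_config \<and> sandpile_add G s u a = u"
      using em(1) idem(1) by blast
  qed
qed

end
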